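(* Let $0<\alpha\le1\le L$ and let $f:\mathbb{R}^d\to\mathbb{R}$ be $\alpha$-strongly convex and $L$-smooth with minimizer $x^*$. Let $(x_k)_{k\ge0}$ be the iterates of the algorithm RHGD with stepsize $0<h\le\frac{1}{4\sqrt L}$ and refreshment rate $\gamma_k=\sqrt\alpha$ for all $k$, from any $x_0\in\mathbb{R}^d$ (and $y_0=0$). Then for all $k\ge0$, $$\mathbb{E}[f(x_k)-f(x^* )]\le\left(1+\frac{\sqrt\alpha\,h}{6}\right)^{-k}\mathbb{E}\left[f(x_0)-f(x^* )+\frac{\alpha}{72}\|x_0-x^*\|^2\right].$$
   Context: $\|\cdot\|$ is the Euclidean norm. A differentiable $f$ is $\alpha$-strongly convex if $f(y)\ge f(x)+\langle\nabla f(x),y-x\rangle+\frac{\alpha}{2}\|y-x\|^2$ for all $x,y$, and $L$-smooth if $\|\nabla f(x)-\nabla f(y)\|\le L\|x-y\|$ for all $x,y$. Randomized Hamiltonian gradient descent (RHGD) with stepsize $h>0$ and refreshment rates $\gamma_k>0$: from $x_0\in\mathbb{R}^d$ and $y_0=0$, for $k=0,1,2,\dots$ set $x_{k+\frac12}=x_k+hy_k$; $x_{k+1}=x_{k+\frac12}-h^2\nabla f(x_{k+\frac12})$; $\tilde y_{k+1}=y_k-h\nabla f(x_{k+1})$; $y_{k+1}=\tilde y_{k+1}$ with probability $1-\min(\gamma_kh,1)$ and $y_{k+1}=0$ with probability $\min(\gamma_kh,1)$, the random choice at each iteration being independent of the past. Expectations are over these random choices (for deterministic $x_0$ the expectation of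 functions of $x_0$ is trivial). *)

theory Defs
  imports "HOL-Probability.Probability"
begin

definition gradient :: "('a::euclidean_space \<Rightarrow> real) \<Rightarrow> 'a \<Rightarrow> 'a" where
  "gradient f x = (THE D. GDERIV f x :> D)"

lemma gradient_unique:
  fixes f :: "'a::euclidean_space \<Rightarrow> real"
  assumes "GDERIV f x :> D" "GDERIV f x :> E"
  shows "D = E"
proof -
  have "(\<lambda>h. inner h D) = (\<lambda>h. inner h E)"
    using assms has_derivative_unique unfolding gderiv_def by blast
  then have "inner h D = inner h E" for h
    by metis
  then show ?thesis
    using vector_eq_ldot by blast
qed

lemma gradient_GDERIV:
  fixes f :: "'a::euclidean_space \<Rightarrow> real"
  assumes "f differentiable at x"
  shows "GDERIV f x :> gradient f x"
proof -
  obtain f' where f': "(f has_derivative f') (at x)"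
    using assms unfolding differentiable_def by blast
  interpret bounded_linear f'
    using f' by (rule has_derivative_bounded_linear)
  define D where "D = (\<Sum>b\<in>Basis. f' b *\<^sub>R b)"
  have "f' h = inner h D" for h
  proof -
    have "f' h = f' (\<Sum>b\<in>Basis. inner h b *\<^sub>R b)"
      by (simp add: euclidean_representation)
    also have "\<dots> = inner h D"
      by (simp add: D_def sum scaleR inner_sum_right mult.commute)
    finally show ?thesis .
  qed
  then have "f' = (\<lambda>h. inner h D)"
    by blast
  then have "GDERIV f x :> D"
    using f' by (simp add: gderiv_def)
  then show ?thesis
    unfolding gradient_def by (rule theI) (use gradient_unique \<open>GDERIV f x :> D\<close> in blast)
qed

definition strongly_convex :: "real \<Rightarrow> ('a::euclidean_space \<Rightarrow> real) \<Rightarrow> bool" where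
  "strongly_convex \<alpha> f \<longleftrightarrow>
     (\<forall>x. f differentiable at x) \<and>
     (\<forall>x y. f y \<ge> f x + inner (gradient f x) (y - x) + \<alpha> / 2 * (norm (y - x))\<^sup>2)"

definition smooth :: "real \<Rightarrow> ('a::euclidean_space \<Rightarrow> real) \<Rightarrow> bool" where
  "smooth L f \<longleftrightarrow>
     (\<forall>x. f differentiable at x) \<and>
     (\<forall>x y. norm (gradient f x - gradient f y) \<le> L * norm (x - y))"

text \<open>
  The random choices, on an arbitrary probability space: \<open>R k\<close> is the event that the
  velocity is reset to zero in the iteration leading from step \<open>k\<close> to step \<open>k + 1\<close>.
  Since the starting point is deterministic, the past at step \<open>k\<close> is a function of
  \<open>R 0, \<dots>, R (k - 1)\<close>, so independence of the past is mutual independence of the \<open>R k\<close>.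
\<close>

definition refreshments ::
    "'w measure \<Rightarrow> real \<Rightarrow> (nat \<Rightarrow> real) \<Rightarrow> (nat \<Rightarrow> 'w \<Rightarrow> bool) \<Rightarrow> bool" where
  "refreshments M h \<gamma> R \<longleftrightarrow>
     prob_space M \<and>
     prob_space.indep_vars M (\<lambda>_. count_space UNIV) R UNIV \<and>
     (\<forall>k. measure M {\<omega> \<in> space M. R k \<omega>} = min (\<gamma> k * h) 1)"

text \<open>The pair \<open>(x\<^sub>k, y\<^sub>k)\<close> on the outcome whose reset decisions are \<open>r 0, r 1, \<dots>\<close>\<close>

primrec rhgd ::
    "('a::euclidean_space \<Rightarrow> real) \<Rightarrow> real \<Rightarrow> 'a \<Rightarrow> (nat \<Rightarrow> bool) \<Rightarrow> nat \<Rightarrow> 'a \<times> 'a" where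
  "rhgd f h x0 r 0 = (x0, 0)"
| "rhgd f h x0 r (Suc k) =
    (let (x, y) = rhgd f h x0 r k;
         x_half = x + h *\<^sub>R y;
         x_next = x_half - h\<^sup>2 *\<^sub>R gradient f x_half;
         y_tilde = y - h *\<^sub>R gradient f x_next
     in (x_next, if r k then 0 else y_tilde))"

definition rhgd_x ::
    "('a::euclidean_space \<Rightarrow> real) \<Rightarrow> real \<Rightarrow> 'a \<Rightarrow> (nat \<Rightarrow> 'w \<Rightarrow> bool) \<Rightarrow> nat \<Rightarrow> 'w \<Rightarrow> 'a" where
  "rhgd_x f h x0 R k \<omega> = fst (rhgd f h x0 (\<lambda>i. R i \<omega>) k)"

end

theory Submission
  imports Defs
begin

text \<open>
  Write \<open>s = sqrt \<alpha>\<close>. The proof exhibits a Lyapunov function,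
  \<open>V(x, y) = f x - f x* + 1/2 * |y + (s/6) * (x - x*)|^2\<close>, whose expectation shrinks by the
  factor \<open>1 / (1 + s h / 6)\<close> in every iteration. It dominates \<open>f x - f x*\<close>, and at \<open>y = 0\<close> it equals
  \<open>f x - f x* + (\<alpha>/72) * |x - x*|^2\<close>, which is where the constant 72 comes from.

  The form of \<open>V\<close> is easiest to see in continuous time, where \<open>x' = y\<close>, \<open>y' = - \<nabla>f x\<close> and \<open>y\<close> is
  reset to zero at rate \<open>s\<close>. The flow conserves the energy \<open>f x + |y|^2 / 2\<close>, so it cannot by itself
  bring \<open>f x\<close> down. Resets destroy the kinetic energy at rate \<open>s * |y|^2 / 2\<close>, and the flow
  changes the cross term \<open>(s/6) * <x - x*, y>\<close> at rate \<open>(s/6) * |y|^2 - (s/6) * <x - x*, \<nabla>f x>\<close>. The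
  first part is a third of the kinetic loss; by strong convexity the second is at most \<open>- (s/6) * (f x - f x* + (\<alpha>/2) * |x - x*|^2)\<close>.
  So each of the three quantities in \<open>V\<close> is damped at a rate of order \<open>s\<close>, and the weight \<open>1/6\<close> is small
  enough for the remaining cross terms to be absorbed.

  In discrete time the energy balance only holds up to terms of order \<open>h^2\<close> that involve the gradient.
  They are paid for by the gradient step: convexity at the new point shows that one iteration before the
  reset loses energy of about \<open>h^2 / 2 * |\<nabla>f|^2\<close>. This requires the gradients at the intermediate
  point and at the new point to be close, which smoothness and \<open>L h^2 \<le> 1/16\<close> guarantee.
  Lemma \<open>lyapunov_step\<close> proves the resulting inequality pointwise, with the average over the
  reset decision written out; \<open>expectation_independent_choice\<close> turns it into a
  statement about expectations.
\<close>

section \<open>One iteration contracts the Lyapunov function\<close>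

definition lyapunov ::
    "('a::euclidean_space \<Rightarrow> real) \<Rightarrow> 'a \<Rightarrow> real \<Rightarrow> 'a \<Rightarrow> 'a \<Rightarrow> real" where
  "lyapunov f xs s x y = f x - f xs + (norm (y + (s / 6) *\<^sub>R (x - xs)))\<^sup>2 / 2"

text \<open>
  The scalar inequality that is left after Cauchy--Schwarz. In the application \<open>W\<close>, \<open>Z\<close>, \<open>G\<close> and \<open>E\<close> are
  the norms of the velocity, of \<open>s\<close> times the distance to the minimizer, of \<open>h\<close> times the gradient, and
  of \<open>h\<close> times the gradient error, and \<open>\<tau> = s h\<close>. All terms but \<open>G\<^sup>2 / 2\<close> and \<open>E * G\<close> are
  of order \<open>\<tau>\<close>; as \<open>\<tau> \<le> 1/4\<close>, what remains of \<open>G\<^sup>2 / 2\<close> is a large multiple of \<open>\<tau> * G\<^sup>2\<close>, so that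
  after division by \<open>\<tau>\<close> a diagonally dominant quadratic form in \<open>W\<close>, \<open>Z\<close>, \<open>G\<close> is left.
\<close>

lemma dissipation_absorbs_cross_terms:
  fixes W Z G E \<tau> :: real
  assumes "0 < \<tau>" "\<tau> \<le> 1 / 4" and "0 \<le> W" "0 \<le> Z" "0 \<le> E" "15 * E \<le> G"
  shows "\<tau> * (1 / 9 + \<tau> / 36) * (Z * W) + \<tau> / 6 * (W * G) + \<tau> / 6 * (E * W) + \<tau> / 6 * (E * G)
      + \<tau> / 36 * (Z * E) + \<tau>\<^sup>2 / 36 * (W * E) + E * G
    \<le> \<tau> / 4 * W\<^sup>2 + 35 / 432 * \<tau> * Z\<^sup>2 + G\<^sup>2 / 2"
proof -
  have G: "0 \<le> G" and E: "E \<le> G / 15"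
    using assms by auto
  have EG: "E * G \<le> G\<^sup>2 / 15" and EW: "E * W \<le> W * G / 15" and ZE: "Z * E \<le> Z * G / 15"
    using mult_right_mono[OF E G] mult_right_mono[OF E \<open>0 \<le> W\<close>] mult_left_mono[OF E \<open>0 \<le> Z\<close>]
    by (simp_all add: power2_eq_square mult.commute)
  have nn: "0 \<le> Z * W" "0 \<le> W * G" "0 \<le> Z * G" "0 \<le> E * W" "0 \<le> E * G" "0 \<le> Z * E"
    using assms G by simp_all
  have "\<tau> * (1 / 9 + \<tau> / 36) * (Z * W) \<le> \<tau> * (17 / 144 * (Z * W))"
    unfolding mult.assoc using assms nn by (intro mult_left_mono mult_right_mono) auto
  moreover have "\<tau>\<^sup>2 / 36 * (W * E) \<le> \<tau> * (1 / 144 * (E * W))"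
  proof -
    have "\<tau> * (\<tau> / 36 * (E * W)) \<le> \<tau> * (1 / 144 * (E * W))"
      using assms nn by (intro mult_left_mono mult_right_mono) auto
    then show ?thesis
      by (simp add: power2_eq_square mult_ac)
  qed
  \<comment> \<open>The coefficient 26/15 is four times \<open>1/2 - 1/15\<close>, what \<open>E * G \<le> G\<^sup>2 / 15\<close> leaves of \<open>G\<^sup>2 / 2\<close>.\<close>
  moreover have "\<tau> * (17 / 144 * (Z * W) + W * G / 6 + E * W / 6 + E * G / 6 + Z * E / 36 + E * W / 144)
      \<le> \<tau> * (W\<^sup>2 / 4 + 35 / 432 * Z\<^sup>2 + 26 / 15 * G\<^sup>2)"
  proof (rule mult_left_mono)
    \<comment> \<open>Weighted Young inequalities that share out the coefficients of \<open>W\<^sup>2\<close>, \<open>Z\<^sup>2\<close> and \<open>G\<^sup>2\<close> on the right.\<close>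
    have "0 \<le> (3 / 5 * Z - W / 2)\<^sup>2 / 5" "0 \<le> (W / 2 - G)\<^sup>2 / 5" "0 \<le> (Z - 9 * G)\<^sup>2 / 240"
      by simp_all
    then have "3 / 25 * (Z * W) \<le> 9 / 125 * Z\<^sup>2 + W\<^sup>2 / 20"
      and "W * G / 5 \<le> W\<^sup>2 / 20 + G\<^sup>2 / 5"
      and "3 / 40 * (Z * G) \<le> Z\<^sup>2 / 240 + 81 / 240 * G\<^sup>2"
      by (simp_all add: power2_eq_square algebra_simps)
    then show "17 / 144 * (Z * W) + W * G / 6 + E * W / 6 + E * G / 6 + Z * E / 36 + E * W / 144
      \<le> W\<^sup>2 / 4 + 35 / 432 * Z\<^sup>2 + 26 / 15 * G\<^sup>2"
      using EG EW ZE nn zero_le_power2[of W] zero_le_power2[of Z] zero_le_power2[of G] by linarith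
  qed (use assms in simp)
  moreover have "\<tau> * (26 / 15 * G\<^sup>2) \<le> 1 / 4 * (26 / 15 * G\<^sup>2)"
    using assms by (intro mult_right_mono) simp_all
  ultimately show ?thesis
    using EG by (simp add: algebra_simps)
qed

text \<open>
  One iteration in coordinates centred at its endpoint: \<open>z\<close> is the new position relative to the
  minimizer, \<open>v\<close> the velocity before the reset, \<open>g\<close> the gradient at the new point, and \<open>g + e\<close> the
  gradient at the intermediate point. In these coordinates the previous velocity is \<open>v + h g\<close>, and the
  previous position relative to the minimizer is \<open>z - h v + h\<^sup>2 e\<close>: the gradients in the position and the velocity update
  cancel up to the error \<open>e\<close>. The objective enters only through its gap \<open>F\<close> at the new point, and the
  gap at the previous point is replaced by its lower bound from convexity.
\<close>

lemma lyapunov_decrease_quadratic: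
  fixes z v g e :: "'a::real_inner" and s h F :: real
  assumes "0 < s" "0 < h" "s * h \<le> 1 / 4"
    and e: "15 * norm e \<le> norm g"
    and F: "F \<le> inner z g - s\<^sup>2 / 2 * (norm z)\<^sup>2"
  shows "(1 + s * h / 6) * (F + (1 - s * h) * ((norm (v + (s / 6) *\<^sub>R z))\<^sup>2 / 2)
        + s * h * ((norm ((s / 6) *\<^sub>R z))\<^sup>2 / 2))
    \<le> F + inner g (h\<^sup>2 *\<^sub>R e - h *\<^sub>R v)
      + (norm (v + h *\<^sub>R g + (s / 6) *\<^sub>R (z - h *\<^sub>R v + h\<^sup>2 *\<^sub>R e)))\<^sup>2 / 2"
    (is "?lhs \<le> ?rhs")
proof -
  define \<tau> where "\<tau> = s * h"
  have \<tau>: "0 < \<tau>" "\<tau> \<le> 1 / 4"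
    using assms by (simp_all add: \<tau>_def)
  \<comment> \<open>The terms of order zero in \<open>\<tau>\<close> reduce to \<open>h\<^sup>2 |g|\<^sup>2 / 2 + h\<^sup>2 <e, g>\<close>, the energy dissipated by the
    gradient step; in the coefficient of \<open>|v|\<^sup>2\<close>, the reset contributes \<open>5 \<tau> / 12 + \<tau>\<^sup>2 / 12\<close>, after the factor
    \<open>1 + \<tau> / 6\<close>, and the change of the cross term \<open>- \<tau> / 6\<close>.\<close>
  have expand: "?rhs - ?lhs = \<tau> / 6 * (inner z g - F)
      + (5 * \<tau> / 12 + \<tau>\<^sup>2 / 12 - \<tau> / 6 + \<tau>\<^sup>2 / 72) * (norm v)\<^sup>2
      + s * \<tau> * (1 / 9 + \<tau> / 36) * inner z v
      - s\<^sup>2 * \<tau> / 432 * (norm z)\<^sup>2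
      + h\<^sup>2 * (norm g)\<^sup>2 / 2 + h\<^sup>2 * inner e g
      - \<tau> * h / 6 * inner v g + \<tau> * h / 6 * inner e v + \<tau> * h\<^sup>2 / 6 * inner e g
      + \<tau> * s * h / 36 * inner z e - \<tau>\<^sup>2 * h / 36 * inner v e + \<tau>\<^sup>2 * h\<^sup>2 / 72 * (norm e)\<^sup>2"
    unfolding \<tau>_def power2_norm_eq_inner
    by (simp add: inner_add_left inner_add_right inner_diff_left inner_diff_right inner_commute)
      (simp add: inner_commute power2_eq_square power4_eq_xxxx field_simps)
  define W Z G E where "W = norm v" and "Z = s * norm z" and "G = h * norm g" and "E = h * norm e"
  have main: "\<tau> * (1 / 9 + \<tau> / 36) * (Z * W) + \<tau> / 6 * (W * G) + \<tau> / 6 * (E * W) + \<tau> / 6 * (E * G)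
      + \<tau> / 36 * (Z * E) + \<tau>\<^sup>2 / 36 * (W * E) + E * G
    \<le> \<tau> / 4 * W\<^sup>2 + 35 / 432 * \<tau> * Z\<^sup>2 + G\<^sup>2 / 2"
    using \<tau> assms mult_left_mono[OF e, of h]
    by (intro dissipation_absorbs_cross_terms) (simp_all add: W_def Z_def G_def E_def algebra_simps)
  have cs: "- (c * (norm a * norm b)) \<le> c * inner a b" "- (c * (norm a * norm b)) \<le> - (c * inner a b)"
    if "0 \<le> c" for a b :: 'a and c
    using mult_left_mono[OF Cauchy_Schwarz_ineq2[of a b] that] mult_left_mono[OF abs_ge_self[of "inner a b"] that]
      mult_left_mono[OF abs_ge_minus_self[of "inner a b"] that] by auto
  have "\<tau> / 6 * (s\<^sup>2 / 2 * (norm z)\<^sup>2) \<le> \<tau> / 6 * (inner z g - F)"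
    using F \<tau> by (intro mult_left_mono) auto
  moreover have "\<tau> / 4 * W\<^sup>2 \<le> (5 * \<tau> / 12 + \<tau>\<^sup>2 / 12 - \<tau> / 6 + \<tau>\<^sup>2 / 72) * (norm v)\<^sup>2"
    unfolding W_def by (intro mult_right_mono) auto
  moreover have "- (\<tau> * (1 / 9 + \<tau> / 36) * (Z * W)) \<le> s * \<tau> * (1 / 9 + \<tau> / 36) * inner z v"
    using cs(1)[of "s * \<tau> * (1 / 9 + \<tau> / 36)" z v] \<tau> assms(1) by (simp add: Z_def W_def mult_ac)
  moreover have "- (E * G) \<le> h\<^sup>2 * inner e g"
    using cs(1)[of "h\<^sup>2" e g] by (simp add: E_def G_def power2_eq_square mult_ac)
  moreover have "- (\<tau> / 6 * (W * G)) \<le> - (\<tau> * h / 6 * inner v g)"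
    using cs(2)[of "\<tau> * h / 6" v g] \<tau> assms(2) by (simp add: W_def G_def mult_ac)
  moreover have "- (\<tau> / 6 * (E * W)) \<le> \<tau> * h / 6 * inner e v"
    using cs(1)[of "\<tau> * h / 6" e v] \<tau> assms(2) by (simp add: W_def E_def mult_ac)
  moreover have "- (\<tau> / 6 * (E * G)) \<le> \<tau> * h\<^sup>2 / 6 * inner e g"
    using cs(1)[of "\<tau> * h\<^sup>2 / 6" e g] \<tau> by (simp add: E_def G_def power2_eq_square mult_ac)
  moreover have "- (\<tau> / 36 * (Z * E)) \<le> \<tau> * s * h / 36 * inner z e"
    using cs(1)[of "\<tau> * s * h / 36" z e] \<tau> assms(1,2) by (simp add: Z_def E_def mult_ac)
  moreover have "- (\<tau>\<^sup>2 / 36 * (W * E)) \<le> - (\<tau>\<^sup>2 * h / 36 * inner v e)"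
    using cs(2)[of "\<tau>\<^sup>2 * h / 36" v e] assms(2) by (simp add: W_def E_def mult_ac)
  moreover have "0 \<le> \<tau>\<^sup>2 * h\<^sup>2 / 72 * (norm e)\<^sup>2"
    by simp
  moreover have "35 / 432 * \<tau> * Z\<^sup>2 = \<tau> / 6 * (s\<^sup>2 / 2 * (norm z)\<^sup>2) - s\<^sup>2 * \<tau> / 432 * (norm z)\<^sup>2"
    by (simp add: Z_def power_mult_distrib algebra_simps)
  moreover have "G\<^sup>2 / 2 = h\<^sup>2 * (norm g)\<^sup>2 / 2"
    by (simp add: G_def power_mult_distrib)
  ultimately have "0 \<le> ?rhs - ?lhs"
    using main unfolding expand by linarith
  then show ?thesis
    by linarith
qed

lemma stepsize_le_quarter:
  fixes L h :: real
  assumes "1 \<le> L" "h \<le> 1 / (4 * sqrt L)"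
  shows "h \<le> 1 / 4"
proof -
  have "1 / (4 * sqrt L) \<le> 1 / 4"
    using assms(1) by (simp add: field_simps)
  then show ?thesis
    using assms(2) by linarith
qed

text \<open>
  Strong convexity is used at the new point twice: towards the minimizer, to bound the gap \<open>F\<close>, and
  towards the previous point, to account for the change of potential energy. Smoothness bounds the
  difference of the gradients at the intermediate and the new point: the two points differ by \<open>h\<^sup>2\<close> times
  the gradient at the first, so the difference is at most \<open>L h\<^sup>2 \<le> 1/16\<close> times the norm of that gradient.
\<close>

lemma lyapunov_step:
  fixes f :: "'a::euclidean_space \<Rightarrow> real" and x y xs :: 'a and s h L :: real
  assumes "0 < s" "s \<le> 1" "1 \<le> L"
    and sc: "strongly_convex (s\<^sup>2) f" and sm: "smooth L f"
    and h: "0 < h" "h \<le> 1 / (4 * sqrt L)"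
    and x_half: "x_half = x + h *\<^sub>R y"
    and x_next: "x_next = x_half - h\<^sup>2 *\<^sub>R gradient f x_half"
    and y_tilde: "y_tilde = y - h *\<^sub>R gradient f x_next"
  shows "(1 + s * h / 6) *
      (s * h * lyapunov f xs s x_next 0 + (1 - s * h) * lyapunov f xs s x_next y_tilde)
    \<le> lyapunov f xs s x y"
proof -
  define g e z F where "g = gradient f x_next" and "e = gradient f x_half - g"
    and "z = x_next - xs" and "F = f x_next - f xs"
  have "h\<^sup>2 \<le> (1 / (4 * sqrt L))\<^sup>2"
    using h by (intro power_mono) auto
  then have Lh: "L * h\<^sup>2 \<le> 1 / 16"
    using \<open>1 \<le> L\<close> by (simp add: power_mult_distrib field_simps)
  have "norm e \<le> L * norm (x_half - x_next)"
    using sm by (simp add: smooth_def e_def g_def)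
  also have "\<dots> = L * h\<^sup>2 * norm (g + e)"
    by (simp add: x_next e_def)
  also have "\<dots> \<le> 1 / 16 * norm (g + e)"
    using Lh by (intro mult_right_mono) auto
  also have "\<dots> \<le> 1 / 16 * (norm g + norm e)"
    using norm_triangle_ineq[of g e] by simp
  finally have e: "15 * norm e \<le> norm g"
    by simp
  have sh: "s * h \<le> 1 / 4"
    using mult_mono[of s 1 h "1 / 4"] assms stepsize_le_quarter[of L h] by auto
  have "f x_next + inner g (xs - x_next) + s\<^sup>2 / 2 * (norm (xs - x_next))\<^sup>2 \<le> f xs"
    using sc by (simp add: strongly_convex_def g_def)
  then have F: "F \<le> inner z g - s\<^sup>2 / 2 * (norm z)\<^sup>2"
    by (simp add: F_def z_def norm_minus_commute inner_diff_left inner_diff_right inner_commute)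
  have y: "y = y_tilde + h *\<^sub>R g"
    by (simp add: y_tilde g_def)
  have step: "x - x_next = h\<^sup>2 *\<^sub>R e - h *\<^sub>R y_tilde"
    by (simp add: x_next e_def x_half y algebra_simps power2_eq_square)
  then have xz: "x - xs = z - h *\<^sub>R y_tilde + h\<^sup>2 *\<^sub>R e"
    by (simp add: z_def algebra_simps)
  have "f x_next + inner g (x - x_next) + s\<^sup>2 / 2 * (norm (x - x_next))\<^sup>2 \<le> f x"
    using sc by (simp add: strongly_convex_def g_def)
  moreover have "0 \<le> s\<^sup>2 / 2 * (norm (x - x_next))\<^sup>2"
    by simp
  ultimately have fx: "F + inner g (h\<^sup>2 *\<^sub>R e - h *\<^sub>R y_tilde) \<le> f x - f xs"
    unfolding F_def step by linarith
  have "(1 + s * h / 6) *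
      (s * h * lyapunov f xs s x_next 0 + (1 - s * h) * lyapunov f xs s x_next y_tilde)
    = (1 + s * h / 6) * (F + (1 - s * h) * ((norm (y_tilde + (s / 6) *\<^sub>R z))\<^sup>2 / 2)
        + s * h * ((norm ((s / 6) *\<^sub>R z))\<^sup>2 / 2))"
    by (simp add: lyapunov_def F_def z_def algebra_simps)
  also have "\<dots> \<le> F + inner g (h\<^sup>2 *\<^sub>R e - h *\<^sub>R y_tilde)
      + (norm (y_tilde + h *\<^sub>R g + (s / 6) *\<^sub>R (z - h *\<^sub>R y_tilde + h\<^sup>2 *\<^sub>R e)))\<^sup>2 / 2"
    using assms(1) h(1) sh e F by (rule lyapunov_decrease_quadratic)
  also have "\<dots> \<le> lyapunov f xs s x y"
    using fx unfolding lyapunov_def xz[symmetric] y[symmetric] by linarith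
  finally show ?thesis .
qed

section \<open>Averaging over an independent reset decision\<close>

text \<open>
  The first \<open>k\<close> decisions form a random element of a finite discrete
  space, on which every function is measurable and bounded.
\<close>

lemma (in prob_space) integrable_finitely_many_choices:
  fixes R :: "nat \<Rightarrow> 'a \<Rightarrow> bool" and A :: "(nat \<Rightarrow> bool) \<Rightarrow> real"
  assumes R: "\<And>i. random_variable (count_space UNIV) (R i)"
    and A: "\<And>r. A r = A (restrict r {..<k})"
  shows "integrable M (\<lambda>\<omega>. A (\<lambda>i. R i \<omega>))"
proof -
  let ?P = "{..<k} \<rightarrow>\<^sub>E (UNIV :: bool set)"
  have "(\<lambda>\<omega>. restrict (\<lambda>i. R i \<omega>) {..<k}) \<in> measurable M (PiM {..<k} (\<lambda>_. count_space UNIV))"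
    using R by (intro measurable_restrict) auto
  then have "(\<lambda>\<omega>. restrict (\<lambda>i. R i \<omega>) {..<k}) \<in> measurable M (count_space ?P)"
    by (simp add: count_space_PiM_finite)
  then have "(\<lambda>\<omega>. A (restrict (\<lambda>i. R i \<omega>) {..<k})) \<in> borel_measurable M"
    by (rule measurable_compose) simp
  then have "(\<lambda>\<omega>. A (\<lambda>i. R i \<omega>)) \<in> borel_measurable M"
    using A by (metis (no_types, lifting) measurable_cong)
  moreover have "finite ((\<lambda>r. \<bar>A r\<bar>) ` ?P)"
    by (simp add: finite_PiE)
  then have "\<bar>A (\<lambda>i. R i \<omega>)\<bar> \<le> Max ((\<lambda>r. \<bar>A r\<bar>) ` ?P)" for \<omega>
    by (subst A, intro Max_ge imageI) auto
  ultimately show ?thesis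
    by (intro integrable_const_bound[where B = "Max ((\<lambda>r. \<bar>A r\<bar>) ` ?P)"]) auto
qed

text \<open>
  The law of total expectation for a decision that is independent of the past; the past of step \<open>k\<close> is
  whatever depends on the decisions before \<open>k\<close> only. Writing the choice as a sum of products
  of an indicator with a function of the past makes independence applicable.
\<close>

lemma (in prob_space) expectation_independent_choice:
  fixes R :: "nat \<Rightarrow> 'a \<Rightarrow> bool" and A B :: "(nat \<Rightarrow> bool) \<Rightarrow> real"
  assumes ind: "indep_vars (\<lambda>_. count_space UNIV) R UNIV"
    and p: "prob {\<omega> \<in> space M. R k \<omega>} = p"
    and A: "\<And>r. A r = A (restrict r {..<k})" and B: "\<And>r. B r = B (restrict r {..<k})"
  shows "expectation (\<lambda>\<omega>. if R k \<omega> then A (\<lambda>i. R i \<omega>) else B (\<lambda>i. R i \<omega>))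
    = p * expectation (\<lambda>\<omega>. A (\<lambda>i. R i \<omega>)) + (1 - p) * expectation (\<lambda>\<omega>. B (\<lambda>i. R i \<omega>))"
proof -
  have R: "random_variable (count_space UNIV) (R i)" for i
    using ind by (auto simp: indep_vars_def)
  define I where "I b \<omega> = (of_bool (R k \<omega> = b) :: real)" for b \<omega>
  have intI: "integrable M (I b)" for b
    unfolding I_def
    by (rule integrable_const_bound[where B = 1])
      (auto intro!: measurable_compose[OF R[of k], of "\<lambda>r. of_bool (r = b)"])
  have prodE: "expectation (\<lambda>\<omega>. I b \<omega> * C (\<lambda>i. R i \<omega>))
      = expectation (I b) * expectation (\<lambda>\<omega>. C (\<lambda>i. R i \<omega>))"
    and prodI: "integrable M (\<lambda>\<omega>. I b \<omega> * C (\<lambda>i. R i \<omega>))"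
    if C: "\<And>r. C r = C (restrict r {..<k})" for b and C :: "(nat \<Rightarrow> bool) \<Rightarrow> real"
  proof -
    have "indep_var borel ((\<lambda>r. of_bool (r k = b)) \<circ> (\<lambda>\<omega>. restrict (\<lambda>i. R i \<omega>) {k}))
        borel (C \<circ> (\<lambda>\<omega>. restrict (\<lambda>i. R i \<omega>) {..<k}))"
      by (intro indep_var_compose[OF indep_var_restrict[OF ind]])
        (auto simp: count_space_PiM_finite)
    moreover have "C \<circ> (\<lambda>\<omega>. restrict (\<lambda>i. R i \<omega>) {..<k}) = (\<lambda>\<omega>. C (\<lambda>i. R i \<omega>))"
      using C[symmetric] by (simp add: o_def)
    moreover have "(\<lambda>r. of_bool (r k = b)) \<circ> (\<lambda>\<omega>. restrict (\<lambda>i. R i \<omega>) {k}) = I b"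
      by (simp add: fun_eq_iff I_def)
    ultimately have iv: "indep_var borel (I b) borel (\<lambda>\<omega>. C (\<lambda>i. R i \<omega>))"
      by simp
    note intC = integrable_finitely_many_choices[of R C k, OF R C]
    show "expectation (\<lambda>\<omega>. I b \<omega> * C (\<lambda>i. R i \<omega>))
      = expectation (I b) * expectation (\<lambda>\<omega>. C (\<lambda>i. R i \<omega>))"
      by (rule indep_var_lebesgue_integral[OF iv intI intC])
    show "integrable M (\<lambda>\<omega>. I b \<omega> * C (\<lambda>i. R i \<omega>))"
      by (rule indep_var_integrable[OF iv intI intC])
  qed
  have ev: "{\<omega> \<in> space M. R k \<omega>} \<in> events"
    using measurable_sets[OF R[of k], of "{True}"] by (simp add: vimage_def Int_def conj_commute)
  have "expectation (I True) = expectation (indicator {\<omega> \<in> space M. R k \<omega>})"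
    by (intro Bochner_Integration.integral_cong) (auto simp: I_def indicator_def)
  then have IT: "expectation (I True) = p"
    using ev p by simp
  have "expectation (I False) = expectation (\<lambda>\<omega>. 1 - I True \<omega>)"
    by (intro Bochner_Integration.integral_cong) (auto simp: I_def)
  then have IF: "expectation (I False) = 1 - p"
    using intI IT by (simp add: prob_space)
  have "expectation (\<lambda>\<omega>. if R k \<omega> then A (\<lambda>i. R i \<omega>) else B (\<lambda>i. R i \<omega>))
    = expectation (\<lambda>\<omega>. I True \<omega> * A (\<lambda>i. R i \<omega>) + I False \<omega> * B (\<lambda>i. R i \<omega>))"
    by (intro Bochner_Integration.integral_cong) (auto simp: I_def)
  also have "\<dots> = p * expectation (\<lambda>\<omega>. A (\<lambda>i. R i \<omega>)) + (1 - p) * expectation (\<lambda>\<omega>. B (\<lambda>i. R i \<omega>))"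
    using prodI[of A, OF A] prodI[of B, OF B]
    by (simp add: prodE[of A, OF A] prodE[of B, OF B] IT IF)
  finally show ?thesis .
qed

section \<open>Convergence in expectation\<close>

lemma rhgd_restrict: "rhgd f h x0 r k = rhgd f h x0 (restrict r {..<k}) k"
proof -
  have "rhgd f h x0 r k = rhgd f h x0 r' k" if "\<And>i. i < k \<Longrightarrow> r i = r' i" for r'
    using that by (induction k) (simp_all add: Let_def split: prod.splits)
  from this[of "restrict r {..<k}"] show ?thesis
    by simp
qed

lemma expected_lyapunov_step:
  fixes f :: "'a::euclidean_space \<Rightarrow> real" and x0 xs :: 'a and s h L :: real
    and R :: "nat \<Rightarrow> 'w \<Rightarrow> bool"
  assumes s: "0 < s" "s \<le> 1" "1 \<le> L"
    and f: "strongly_convex (s\<^sup>2) f" "smooth L f"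
    and h: "0 < h" "h \<le> 1 / (4 * sqrt L)"
    and R: "refreshments M h (\<lambda>_. s) R"
  defines "V \<equiv> \<lambda>k \<omega>. case_prod (lyapunov f xs s) (rhgd f h x0 (\<lambda>i. R i \<omega>) k)"
  shows "(1 + s * h / 6) * integral\<^sup>L M (V (Suc k)) \<le> integral\<^sup>L M (V k)"
proof -
  interpret prob_space M
    using R by (simp add: refreshments_def)
  have ind: "indep_vars (\<lambda>_. count_space UNIV) R UNIV"
    using R by (simp add: refreshments_def)
  then have rv: "random_variable (count_space UNIV) (R i)" for i
    by (auto simp: indep_vars_def)
  \<comment> \<open>The truncation of the reset probability at 1 is never active.\<close>
  have "s * h \<le> 1"
    using mult_mono[of s 1 h 1] s h stepsize_le_quarter[OF s(3) h(2)] by auto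
  then have p: "prob {\<omega> \<in> space M. R k \<omega>} = s * h"
    using R by (simp add: refreshments_def)
  \<comment> \<open>The position after iteration \<open>k\<close> and the velocity before the reset depend only on the
    decisions before \<open>k\<close>.\<close>
  define X where "X r = (let (x, y) = rhgd f h x0 r k; x_half = x + h *\<^sub>R y
      in x_half - h\<^sup>2 *\<^sub>R gradient f x_half)" for r
  define Y where "Y r = snd (rhgd f h x0 r k) - h *\<^sub>R gradient f (X r)" for r
  define A where "A r = lyapunov f xs s (X r) 0" for r
  define B where "B r = lyapunov f xs s (X r) (Y r)" for r
  define C where "C r = case_prod (lyapunov f xs s) (rhgd f h x0 r k)" for r
  have XY: "X r = X (restrict r {..<k})" "Y r = Y (restrict r {..<k})" for r
    using rhgd_restrict[of f h x0 r k] by (simp_all add: X_def Y_def)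
  have A: "A r = A (restrict r {..<k})" and B: "B r = B (restrict r {..<k})"
    and C: "C r = C (restrict r {..<k})" for r
    using XY[of r] rhgd_restrict[of f h x0 r k] by (simp_all add: A_def B_def C_def)
  have int: "integrable M (\<lambda>\<omega>. A (\<lambda>i. R i \<omega>))" "integrable M (\<lambda>\<omega>. B (\<lambda>i. R i \<omega>))"
    "integrable M (\<lambda>\<omega>. C (\<lambda>i. R i \<omega>))"
    by (rule integrable_finitely_many_choices[OF rv], rule A B C)+
  have "V (Suc k) = (\<lambda>\<omega>. if R k \<omega> then A (\<lambda>i. R i \<omega>) else B (\<lambda>i. R i \<omega>))"
    by (auto simp: fun_eq_iff V_def A_def B_def X_def Y_def Let_def split: prod.splits)
  then have "(1 + s * h / 6) * expectation (V (Suc k)) = expectation (\<lambda>\<omega>. (1 + s * h / 6) *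
      (s * h * A (\<lambda>i. R i \<omega>) + (1 - s * h) * B (\<lambda>i. R i \<omega>)))"
    using int by (simp add: expectation_independent_choice[where A = A and B = B, OF ind p A B])
  also have "\<dots> \<le> expectation (\<lambda>\<omega>. C (\<lambda>i. R i \<omega>))"
  proof (rule integral_mono)
    show "(1 + s * h / 6) * (s * h * A (\<lambda>i. R i \<omega>) + (1 - s * h) * B (\<lambda>i. R i \<omega>)) \<le> C (\<lambda>i. R i \<omega>)" for \<omega>
      unfolding A_def B_def C_def case_prod_beta
      by (rule lyapunov_step[OF s f h refl]) (simp_all add: X_def Y_def case_prod_beta Let_def)
  qed (use int in auto)
  also have "\<dots> = expectation (V k)"
    by (simp add: C_def V_def)
  finally show ?thesis .
qed

theorem theorem4:
  fixes f :: "real ^ 'd \<Rightarrow> real"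
    and x_star x0 :: "real ^ 'd"
    and \<alpha> L h :: real
    and M :: "'w measure"
    and R :: "nat \<Rightarrow> 'w \<Rightarrow> bool"
  assumes "0 < \<alpha>" and "\<alpha> \<le> 1" and "1 \<le> L"
    and "strongly_convex \<alpha> f" and "smooth L f"
    and "\<forall>x. f x_star \<le> f x"
    and "0 < h" and "h \<le> 1 / (4 * sqrt L)"
    and "refreshments M h (\<lambda>_. sqrt \<alpha>) R"
  shows "\<forall>k. integral\<^sup>L M (\<lambda>\<omega>. f (rhgd_x f h x0 R k \<omega>) - f x_star)
      \<le> (1 + sqrt \<alpha> * h / 6) powi (- int k) *
        integral\<^sup>L M (\<lambda>\<omega>. f (rhgd_x f h x0 R 0 \<omega>) - f x_star
          + \<alpha> / 72 * (norm (rhgd_x f h x0 R 0 \<omega> - x_star))\<^sup>2)"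
proof
  fix k
  interpret prob_space M
    using assms(9) by (simp add: refreshments_def)
  define s where "s = sqrt \<alpha>"
  have s: "0 < s" "s \<le> 1" "s\<^sup>2 = \<alpha>"
    using assms(1,2) by (simp_all add: s_def)
  define q where "q = 1 + s * h / 6"
  have q: "0 < q"
    using s(1) assms(7) by (simp add: q_def add_pos_pos)
  define V where "V k \<omega> = case_prod (lyapunov f x_star s) (rhgd f h x0 (\<lambda>i. R i \<omega>) k)" for k \<omega>
  have rv: "random_variable (count_space UNIV) (R i)" for i
    using assms(9) by (auto simp: refreshments_def indep_vars_def)
  have step: "q * expectation (V (Suc k)) \<le> expectation (V k)" for k
    using expected_lyapunov_step[of s L f h M R x_star x0 k] s assms
    by (simp add: q_def V_def[abs_def] s_def)
  have decay: "q ^ k * expectation (V k) \<le> expectation (V 0)"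
  proof (induction k)
    case (Suc k)
    have "q ^ Suc k * expectation (V (Suc k)) \<le> q ^ k * expectation (V k)"
      using mult_left_mono[OF step, of "q ^ k" k] q by (simp add: mult_ac)
    then show ?case
      using Suc.IH by linarith
  qed simp
  have "expectation (\<lambda>\<omega>. f (rhgd_x f h x0 R k \<omega>) - f x_star) \<le> expectation (V k)"
  proof (rule integral_mono)
    show "integrable M (\<lambda>\<omega>. f (rhgd_x f h x0 R k \<omega>) - f x_star)"
      unfolding rhgd_x_def
      by (rule integrable_finitely_many_choices[OF rv,
            where k = k and A = "\<lambda>r. f (fst (rhgd f h x0 r k)) - f x_star"])
        (metis rhgd_restrict)
    show "integrable M (V k)"
      unfolding V_def
      by (rule integrable_finitely_many_choices[OF rv,
            where k = k and A = "\<lambda>r. case_prod (lyapunov f x_star s) (rhgd f h x0 r k)"])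
        (metis rhgd_restrict)
  qed (simp add: V_def rhgd_x_def lyapunov_def case_prod_beta)
  also have "\<dots> \<le> expectation (V 0) / q ^ k"
    using decay q by (simp add: pos_le_divide_eq mult.commute)
  also have "\<dots> = q powi (- int k) * expectation (V 0)"
    by (simp add: power_int_minus divide_inverse mult.commute)
  also have "V 0 = (\<lambda>\<omega>. f (rhgd_x f h x0 R 0 \<omega>) - f x_star
          + \<alpha> / 72 * (norm (rhgd_x f h x0 R 0 \<omega> - x_star))\<^sup>2)"
    using s by (simp add: fun_eq_iff V_def rhgd_x_def lyapunov_def power_mult_distrib power_divide)
  finally show "expectation (\<lambda>\<omega>. f (rhgd_x f h x0 R k \<omega>) - f x_star)
      \<le> (1 + sqrt \<alpha> * h / 6) powi (- int k) *
        expectation (\<lambda>\<omega>. f (rhgd_x f h x0 R 0 \<omega>) - f x_star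
          + \<alpha> / 72 * (norm (rhgd_x f h x0 R 0 \<omega> - x_star))\<^sup>2)"
    by (simp add: q_def s_def)
qed

end
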